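(* Let $\sigma = 2\sqrt{2}\,\pi$ and, for a positive integer $N_1$, let $p_j = -\exp\!\big(-\sigma(\sqrt{N_1}-\sqrt{j}\,)\big)$, $1\le j\le N_1$. Assume the following bound holds for all sufficiently large positive integers $N_t$, with $h=2\pi^2$ and $T=\sqrt{N_t h/4}$: for every $x\in[e^{4-2T},1]$, $$\left|\int_\Gamma f(u,x)\,\delta(u)\,du\right| < 12\, e^{-T},$$ with $f,\delta,\Gamma$ as in the context. Then there exist coefficients $a_1,\dots,a_{N_1}$ and a polynomial $b$ of degree $N_2=\mathcal{O}(\sqrt{N_1}\,)$ such that, with $N=N_1+N_2$, the rational function $r(x)=\sum_{j=1}^{N_1}\frac{a_j}{x-p_j}+b(x)$ satisfies $$|r(x)-\sqrt{x}\,| = \mathcal{O}\big(e^{-\pi\sqrt{2N}}\big)$$ as $N\to\infty$, uniformly for $x\in[0,1]$.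
   Context: Here $\sqrt{u}$ denotes the principal branch of the square root. For $u\in\mathbb{C}$ and $x\in(0,1]$, $f(u,x) = \frac{x}{\pi}\,\frac{1}{\sqrt{u}}\,\frac{e^{\sqrt{u}-T}}{e^{2(\sqrt{u}-T)}+x}$. The function $\delta(u)=\mu(u)-m(u)$, where $\mu(u)=-\tfrac12$ if $\operatorname{Im}u\ge 0$ and $\mu(u)=\tfrac12$ if $\operatorname{Im}u<0$, and $m(u) = -\tfrac{i}{2}\cot(\pi u/h)$. The contour $\Gamma$ is the positively oriented boundary of the rectangle $\{u: 1\le \operatorname{Re}u\le 4T^2+1,\ |\operatorname{Im}u|\le a\}$ with $a = 2\pi(T+\tfrac12\log x)$. *)

theory Defs
  imports "HOL-Complex_Analysis.Complex_Analysis" "HOL-Computational_Algebra.Polynomial"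
begin

definition f_int :: "real \<Rightarrow> complex \<Rightarrow> real \<Rightarrow> complex" where
  "f_int T u x = (of_real x / of_real pi) * (1 / csqrt u) *
      (exp (csqrt u - of_real T) / (exp (2 * (csqrt u - of_real T)) + of_real x))"

definition mu_fn :: "complex \<Rightarrow> complex" where
  "mu_fn u = (if Im u \<ge> 0 then - 1/2 else 1/2)"

definition m_fn :: "real \<Rightarrow> complex \<Rightarrow> complex" where
  "m_fn h u = - (\<i> / 2) * cot (of_real pi * u / of_real h)"

definition delta_fn :: "real \<Rightarrow> complex \<Rightarrow> complex" where
  "delta_fn h u = mu_fn u - m_fn h u"

definition Gamma_path :: "real \<Rightarrow> real \<Rightarrow> real \<Rightarrow> complex" where
  "Gamma_path T x =
     (let a = 2 * pi * (T + ln x / 2); R = 4 * T^2 + 1 in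
        linepath (Complex 1 (-a)) (Complex R (-a)) +++
        linepath (Complex R (-a)) (Complex R a) +++
        linepath (Complex R a) (Complex 1 a) +++
        linepath (Complex 1 a) (Complex 1 (-a)))"

definition sigma_c :: real where "sigma_c = 2 * sqrt 2 * pi"

definition pole :: "nat \<Rightarrow> nat \<Rightarrow> real" where
  "pole N1 j = - exp (- sigma_c * (sqrt (real N1) - sqrt (real j)))"

definition rat_approx :: "(nat \<Rightarrow> real) \<Rightarrow> real poly \<Rightarrow> nat \<Rightarrow> real \<Rightarrow> real" where
  "rat_approx a b N1 x = (\<Sum>j=1..N1. a j / (x - pole N1 j)) + poly b x"

end

theory Submission
  imports Defs
begin

text \<open>
  Substituting \<open>t = \<surd>u - T\<close> turns \<open>\<surd>x = (2 x / \<pi>) \<integral> e\<^sup>t / (e\<^sup>2\<^sup>t + x) dt\<close> into an integral of \<open>f(u, x)\<close>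
  over \<open>u\<close>, and the trapezoidal rule with step \<open>h\<close> and \<open>N\<^sub>t = 4 N\<^sub>1\<close> nodes is a rational function of \<open>x\<close>
  whose \<open>j\<close>-th pole is \<open>p\<^sub>j\<close>. By the residue theorem the contour integral of \<open>f \<delta>\<close> over \<open>\<Gamma>\<close> is
  the trapezoidal error, up to truncation of the integral and the contributions of the two poles of
  \<open>f\<close> inside \<open>\<Gamma>\<close>. These poles are \<open>(T + ln x / 2 \<plusminus> i \<pi> / 2)\<^sup>2\<close>; the residues have modulus
  \<open>\<surd>x / \<pi>\<close> and \<open>\<delta>\<close> is \<open>O(e\<^sup>-\<^sup>T / \<surd>x)\<close> there, so all errors are \<open>O(e\<^sup>-\<^sup>T)\<close> with \<open>T = \<pi> \<surd>(2 N\<^sub>1)\<close>.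
  For \<open>x < e\<^bsup>4 - 2T\<^esup>\<close> both \<open>\<surd>x\<close> and the trapezoidal sum are themselves \<open>O(e\<^sup>-\<^sup>T)\<close>.
  The terms with \<open>j > N\<^sub>1\<close> have poles in \<open>(-\<infinity>, -1)\<close>, so their sum is
  approximated on \<open>[0, 1]\<close> within \<open>O(e\<^sup>-\<^sup>T)\<close> by a polynomial of degree \<open>O(T)\<close>; since
  \<open>N\<^sub>2 = O(\<surd>N\<^sub>1)\<close>, replacing \<open>N\<^sub>1\<close> by \<open>N\<close> in the exponent costs only a constant factor.
\<close>

section \<open>Contour integrals over rectangles\<close>

text \<open>The endpoints form a null set. On a segment that reaches the real axis from below,
  \<open>mu_fn\<close> equals 1/2 except at the endpoint on the axis, where it jumps to
  -1/2.\<close>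

lemma has_contour_integral_linepath_cong_interior:
  assumes "(f has_contour_integral i) (linepath a b)"
      and "\<And>t. 0 < t \<Longrightarrow> t < 1 \<Longrightarrow> f (linepath a b t) = g (linepath a b t)"
  shows "(g has_contour_integral i) (linepath a b)"
  unfolding has_contour_integral_linepath
proof (rule has_integral_spike_finite)
  show "((\<lambda>x. f (linepath a b x) * (b - a)) has_integral i) {0..1}"
    using assms(1) by (simp add: has_contour_integral_linepath)
  show "finite {0, 1::real}" by simp
  show "g (linepath a b x) * (b - a) = f (linepath a b x) * (b - a)" if "x \<in> {0..1} - {0, 1}" for x
    using assms(2)[of x] that by simp
qed

text \<open>\<open>mu_fn\<close> weights the boundary below the real axis by 1/2 and above it by
  -1/2. Closing both parts along the axis gives the two half rectangles. They traverse the axis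
  segment in opposite directions and carry opposite weights, so the segment integral is subtracted
  exactly once; the first summand restores it.\<close>

lemma contour_integral_rectpath_sign_jump:
  fixes f :: "complex \<Rightarrow> complex" and c d a :: real
  assumes a: "0 < a" and cd: "c \<le> d"
      and cont: "continuous_on (path_image (rectpath (Complex c (-a)) (Complex d a))
                   \<union> closed_segment (Complex c 0) (Complex d 0)) f"
  shows "((\<lambda>u. f u * mu_fn u) has_contour_integral
            contour_integral (linepath (Complex c 0) (Complex d 0)) f
            + contour_integral (rectpath (Complex c (-a)) (Complex d 0)) f / 2
            - contour_integral (rectpath (Complex c 0) (Complex d a)) f / 2)
          (rectpath (Complex c (-a)) (Complex d a))"
proof -
  define I where "I = (\<lambda>p q. contour_integral (linepath p q) f)"
  let ?B = "path_image (rectpath (Complex c (-a)) (Complex d a))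
                   \<union> closed_segment (Complex c 0) (Complex d 0)"
  have B: "?B = {z. Re z \<in> {c, d} \<and> Im z \<in> {-a..a}} \<union> {z. Im z \<in> {-a, 0, a} \<and> Re z \<in> {c..d}}"
    using a cd by (subst path_image_rectpath)
      (auto simp: closed_segment_same_Im closed_segment_eq_real_ivl)
  have I: "(f has_contour_integral I p q) (linepath p q)" if "closed_segment p q \<subseteq> ?B" for p q
    unfolding I_def
    by (intro has_contour_integral_integral contour_integrable_continuous_linepath
          continuous_on_subset[OF cont that])
  have sV: "closed_segment (Complex r s) (Complex r t) \<subseteq> ?B"
    if "r = c \<or> r = d" "\<bar>s\<bar> \<le> a" "\<bar>t\<bar> \<le> a" for r s t
    using that unfolding B by (auto simp: closed_segment_same_Re closed_segment_eq_real_ivl split: if_splits)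
  have sH: "closed_segment (Complex s r) (Complex t r) \<subseteq> ?B"
    if "r = -a \<or> r = 0 \<or> r = a" "c \<le> s" "s \<le> d" "c \<le> t" "t \<le> d" for r s t
    using that unfolding B by (auto simp: closed_segment_same_Im closed_segment_eq_real_ivl split: if_splits)
  \<comment> \<open>The condition \<open>s < 0 \<or> t < 0\<close> keeps the open segment strictly
    below the real axis, where \<open>mu_fn\<close> is 1/2.\<close>
  have lo: "((\<lambda>u. f u * mu_fn u) has_contour_integral I (Complex r s) (Complex r' t) / 2)
               (linepath (Complex r s) (Complex r' t))"
    if "closed_segment (Complex r s) (Complex r' t) \<subseteq> ?B" "s \<le> 0" "t \<le> 0" "s < 0 \<or> t < 0" for r s r' t
  proof (rule has_contour_integral_linepath_cong_interior)
    show "((\<lambda>u. f u / 2) has_contour_integral I (Complex r s) (Complex r' t) / 2)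
               (linepath (Complex r s) (Complex r' t))"
      using I[OF that(1)] by (rule has_contour_integral_div)
    fix w :: real assume w: "0 < w" "w < 1"
    have "Im (linepath (Complex r s) (Complex r' t) w) = (1 - w) * s + w * t"
      by (simp add: linepath_def)
    also have "\<dots> < 0"
      using that w by (smt (verit, best) mult_nonneg_nonpos mult_pos_neg)
    finally show "f (linepath (Complex r s) (Complex r' t) w) / 2 =
         f (linepath (Complex r s) (Complex r' t) w) * mu_fn (linepath (Complex r s) (Complex r' t) w)"
      by (simp add: mu_fn_def)
  qed
  have up: "((\<lambda>u. f u * mu_fn u) has_contour_integral - (I (Complex r s) (Complex r' t) / 2))
               (linepath (Complex r s) (Complex r' t))"
    if "closed_segment (Complex r s) (Complex r' t) \<subseteq> ?B" "s \<ge> 0" "t \<ge> 0" for r s r' t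
  proof (rule has_contour_integral_linepath_cong_interior)
    show "((\<lambda>u. - (f u / 2)) has_contour_integral - (I (Complex r s) (Complex r' t) / 2))
               (linepath (Complex r s) (Complex r' t))"
      using I[OF that(1)] by (intro has_contour_integral_neg has_contour_integral_div)
    fix w :: real assume w: "0 < w" "w < 1"
    have "0 \<le> (1 - w) * s + w * t" using that w by simp
    also have "\<dots> = Im (linepath (Complex r s) (Complex r' t) w)"
      by (simp add: linepath_def)
    finally show "- (f (linepath (Complex r s) (Complex r' t) w) / 2) =
         f (linepath (Complex r s) (Complex r' t) w) * mu_fn (linepath (Complex r s) (Complex r' t) w)"
      by (simp add: mu_fn_def)
  qed
  have rect: "contour_integral (rectpath (Complex c s) (Complex d t)) f =
      I (Complex c s) (Complex d s) + I (Complex d s) (Complex d t)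
      + I (Complex d t) (Complex c t) + I (Complex c t) (Complex c s)"
    if "s \<in> {-a, 0}" "t \<in> {0, a}" for s t
  proof (rule contour_integral_unique)
    show "(f has_contour_integral I (Complex c s) (Complex d s) + I (Complex d s) (Complex d t)
      + I (Complex d t) (Complex c t) + I (Complex c t) (Complex c s)) (rectpath (Complex c s) (Complex d t))"
      unfolding rectpath_def Let_def add.assoc complex.sel using that a cd
      by (intro has_contour_integral_join I sH sV) (auto)
  qed
  have rev: "I p q = - I q p" for p q
    unfolding I_def using contour_integral_reversepath[of "linepath q p" f] by simp
  have right: "((\<lambda>u. f u * mu_fn u) has_contour_integral
      I (Complex d (-a)) (Complex d 0) / 2 + - (I (Complex d 0) (Complex d a) / 2))
      (linepath (Complex d (-a)) (Complex d a))"
    by (rule has_contour_integral_split[where k = "1/2" and c = "Complex d 0"], rule lo[OF sV],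
        use a in simp_all, rule up[OF sV], use a in \<open>simp_all add: complex_eq_iff\<close>)
  have left: "((\<lambda>u. f u * mu_fn u) has_contour_integral
      - (I (Complex c a) (Complex c 0) / 2) + I (Complex c 0) (Complex c (-a)) / 2)
      (linepath (Complex c a) (Complex c (-a)))"
    by (rule has_contour_integral_split[where k = "1/2" and c = "Complex c 0"], rule up[OF sV],
        use a in simp_all, rule lo[OF sV], use a in \<open>simp_all add: complex_eq_iff\<close>)
  have "((\<lambda>u. f u * mu_fn u) has_contour_integral
     I (Complex c (-a)) (Complex d (-a)) / 2 +
     ((I (Complex d (-a)) (Complex d 0) / 2 + - (I (Complex d 0) (Complex d a) / 2)) +
      (- (I (Complex d a) (Complex c a) / 2) +
       (- (I (Complex c a) (Complex c 0) / 2) + I (Complex c 0) (Complex c (-a)) / 2))))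
     (rectpath (Complex c (-a)) (Complex d a))"
    unfolding rectpath_def Let_def complex.sel using a cd
    by (intro has_contour_integral_join right left lo[OF sH] up[OF sH]) auto
  moreover have "I (Complex c (-a)) (Complex d (-a)) / 2 +
     ((I (Complex d (-a)) (Complex d 0) / 2 + - (I (Complex d 0) (Complex d a) / 2)) +
      (- (I (Complex d a) (Complex c a) / 2) +
       (- (I (Complex c a) (Complex c 0) / 2) + I (Complex c 0) (Complex c (-a)) / 2)))
     = contour_integral (linepath (Complex c 0) (Complex d 0)) f
            + contour_integral (rectpath (Complex c (-a)) (Complex d 0)) f / 2
            - contour_integral (rectpath (Complex c 0) (Complex d a)) f / 2"
  proof -
    have "contour_integral (linepath (Complex c 0) (Complex d 0)) f = I (Complex c 0) (Complex d 0)"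
      by (simp only: I_def)
    with rev[of "Complex d 0" "Complex c 0"] show ?thesis
      by (simp add: rect field_simps)
  qed
  ultimately show ?thesis by (simp only:)
qed

section \<open>Exponential decay of \<open>delta_fn\<close> away from the real axis\<close>

text \<open>By Euler's formula the two quantities are i exp(iz) / (2 sin z) and i exp(-iz) / (2 sin
  z). The numerator has modulus exp(-y/2), and |sin z| is at least sinh(y/2), which is at least
  exp(y/2) / 4 for \<open>y \<ge> 1\<close>. With z = pi u / h these are the values of
  \<open>delta_fn\<close> above and below the axis.\<close>

lemma norm_half_plus_cot_le:
  fixes z :: complex and y :: real
  assumes y: "y \<ge> 1"
  shows "Im z = y / 2 \<Longrightarrow> cmod (- 1/2 + (\<i>/2) * cot z) \<le> 2 * exp (- y)"
    and "Im z = - y / 2 \<Longrightarrow> cmod (1/2 + (\<i>/2) * cot z) \<le> 2 * exp (- y)"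
proof -
  have sin: "cmod (sin z) \<ge> (exp (y/2) - exp (-y/2)) / 2" if "\<bar>Im z\<bar> = y / 2"
  proof (rule power2_le_imp_le)
    have "exp (2 * Im z) + inverse (exp (2 * Im z)) = exp y + exp (-y)"
      using that by (auto simp: exp_minus abs_if mult.commute split: if_splits)
    then have "(cmod (sin z))\<^sup>2 = (exp y + exp (-y) - 2 * cos (2 * Re z)) / 4"
      by (simp add: norm_sin_squared)
    also have "\<dots> \<ge> (exp y + exp (-y) - 2) / 4" by simp
    also have "(exp y + exp (-y) - 2) / 4 = ((exp (y/2) - exp (-y/2)) / 2)\<^sup>2"
      by (simp add: power2_eq_square field_simps flip: exp_add)
    finally show "((exp (y/2) - exp (-y/2)) / 2)\<^sup>2 \<le> (cmod (sin z))\<^sup>2" .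
  qed simp
  have e2: "exp y \<ge> 2" using exp_ge_add_one_self[of y] y by linarith
  have D: "(exp (y/2) - exp (-y/2)) / 2 \<ge> exp (y/2) / 4"
  proof -
    have "2 * exp (-y/2) \<le> exp y * exp (-y/2)" using e2 by simp
    also have "\<dots> = exp (y/2)" by (simp flip: exp_add)
    finally show ?thesis by simp
  qed
  have main: "cmod (\<i> * w / (2 * sin z)) \<le> 2 * exp (-y)"
    if "\<bar>Im z\<bar> = y / 2" "cmod w = exp (-y/2)" for w
  proof -
    have s: "cmod (sin z) \<ge> exp (y/2) / 4" using sin[OF that(1)] D by linarith
    have "cmod (\<i> * w / (2 * sin z)) = exp (-y/2) / (2 * cmod (sin z))"
      by (simp add: norm_divide norm_mult that)
    also have "\<dots> \<le> exp (-y/2) / (2 * (exp (y/2) / 4))"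
      using s by (intro divide_left_mono mult_left_mono) (auto intro!: mult_pos_pos less_le_trans[OF _ s])
    also have "\<dots> = 2 * exp (-y)" by (simp add: field_simps flip: exp_add)
    finally show ?thesis .
  qed
  have nz: "sin z \<noteq> 0" if "\<bar>Im z\<bar> = y / 2"
    using sin[OF that] D by (smt (verit) exp_gt_zero norm_zero divide_pos_pos)
  show "cmod (- 1/2 + (\<i>/2) * cot z) \<le> 2 * exp (- y)" if "Im z = y / 2"
  proof -
    have "- 1/2 + (\<i>/2) * cot z = \<i> * exp (\<i> * z) / (2 * sin z)"
      using nz that y by (simp add: cot_def exp_Euler field_simps)
    moreover have "cmod (exp (\<i> * z)) = exp (-y/2)" using that by simp
    ultimately show ?thesis using main that y by simp
  qed
  show "cmod (1/2 + (\<i>/2) * cot z) \<le> 2 * exp (- y)" if "Im z = - y / 2"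
  proof -
    have e: "exp (- (\<i> * z)) = cos z - \<i> * sin z" using exp_Euler[of "-z"] by simp
    have "\<i> * exp (- (\<i> * z)) = sin z + \<i> * cos z" unfolding e by (simp add: algebra_simps)
    then have "1/2 + (\<i>/2) * cot z = \<i> * exp (- (\<i> * z)) / (2 * sin z)"
      using nz that y by (simp add: cot_def field_simps)
    moreover have "cmod (exp (- (\<i> * z))) = exp (-y/2)" using that by simp
    ultimately show ?thesis using main that y by simp
  qed
qed

section \<open>Poles and residues of the integrand\<close>

definition quadrature_integrand :: "real \<Rightarrow> real \<Rightarrow> real \<Rightarrow> real" where
  "quadrature_integrand T y x =
     x / pi * (1 / sqrt y) * (exp (sqrt y - T) / (exp (2 * (sqrt y - T)) + x))"

lemma f_int_of_real:
  assumes "0 \<le> y"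
  shows "f_int T (of_real y) x = of_real (quadrature_integrand T y x)"
  using assms by (simp add: f_int_def quadrature_integrand_def csqrt_of_real flip: exp_of_real)

lemma quadrature_integrand_pos:
  assumes "0 < y" "0 < x"
  shows "0 < quadrature_integrand T y x"
  using assms unfolding quadrature_integrand_def
  by (intro mult_pos_pos divide_pos_pos add_pos_pos) auto

lemma f_int_denominator_has_field_derivative:
  assumes "0 < Re u"
  shows "((\<lambda>u. exp (2 * (csqrt u - of_real T)) + of_real x) has_field_derivative
            exp (csqrt u - of_real T) ^ 2 / csqrt u) (at u)"
proof -
  have "u \<notin> \<real>\<^sub>\<le>\<^sub>0" using assms by (auto simp: complex_nonpos_Reals_iff)
  then show ?thesis
    by (auto intro!: derivative_eq_intros simp: power2_eq_square simp flip: exp_add mult_2)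
qed

text \<open>The residue at a simple pole is the numerator over the derivative of the denominator. At
  a root that derivative is -x / \<open>csqrt v\<close>, so x and \<open>csqrt v\<close> cancel. The
  factor g will be 1 or \<open>m_fn h\<close>; \<open>g v \<noteq> 0\<close> keeps the numerator
  nonzero, as the rule for simple poles demands.\<close>

lemma residue_f_int_times:
  assumes x: "0 < x" and S: "open S" "connected S" "S \<subseteq> {u. 0 < Re u}" and v: "v \<in> S"
      and root: "exp (csqrt v - of_real T) ^ 2 = - of_real x"
      and g: "g holomorphic_on S" "g v \<noteq> 0"
  shows "residue (\<lambda>u. f_int T u x * g u) v = - (exp (csqrt v - of_real T) / of_real pi) * g v"
proof -
  define num where "num = (\<lambda>u. of_real x / of_real pi * (1 / csqrt u) * exp (csqrt u - of_real T) * g u)"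
  define den where "den = (\<lambda>u. exp (2 * (csqrt u - of_real T)) + complex_of_real x)"
  have R: "0 < Re u" if "u \<in> S" for u using S that by auto
  have np: "u \<notin> \<real>\<^sub>\<le>\<^sub>0" if "u \<in> S" for u using R[OF that] by (auto simp: complex_nonpos_Reals_iff)
  have nz: "csqrt u \<noteq> 0" if "u \<in> S" for u using R[OF that] by auto
  have eq: "(\<lambda>u. f_int T u x * g u) = (\<lambda>u. num u / den u)"
    by (auto simp: f_int_def num_def den_def)
  have "residue (\<lambda>u. num u / den u) v = num v / (exp (csqrt v - of_real T) ^ 2 / csqrt v)"
  proof (rule residue_simple_pole_deriv[of _ S])
    show "num holomorphic_on S" unfolding num_def
      by (intro holomorphic_intros g) (use np nz in auto)
    show "den holomorphic_on S" unfolding den_def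
      by (intro holomorphic_intros) (use np in auto)
    show "(den has_field_derivative exp (csqrt v - of_real T) ^ 2 / csqrt v) (at v)"
      unfolding den_def by (intro f_int_denominator_has_field_derivative R v)
    show "num v \<noteq> 0" using x g(2) nz[OF v] by (simp add: num_def)
    show "den v = 0" unfolding den_def exp_double root by simp
    show "exp (csqrt v - of_real T) ^ 2 / csqrt v \<noteq> 0" using nz[OF v] by simp
  qed (use S v in auto)
  also have "\<dots> = - (exp (csqrt v - of_real T) / of_real pi) * g v"
    unfolding root num_def using x nz[OF v] by (simp add: field_simps)
  finally show ?thesis unfolding eq .
qed

text \<open>The sign s selects the pole in the upper or the lower half plane. Positivity of T + ln x
  / 2 puts the squared number in the right half plane, where \<open>csqrt\<close> undoes
  squaring.\<close>

lemma f_int_pole: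
  fixes s :: real
  assumes x: "0 < x" and b: "0 < T + ln x / 2" and s: "s = 1 \<or> s = -1"
  defines "v \<equiv> (Complex (T + ln x / 2) (s * pi / 2))\<^sup>2"
  shows csqrt_f_int_pole: "csqrt v = Complex (T + ln x / 2) (s * pi / 2)"
    and exp_f_int_pole: "exp (csqrt v - of_real T) = of_real s * \<i> * of_real (sqrt x)"
    and Re_f_int_pole: "Re v = (T + ln x / 2)\<^sup>2 - pi\<^sup>2 / 4"
    and Im_f_int_pole: "Im v = s * pi * (T + ln x / 2)"
proof -
  show c: "csqrt v = Complex (T + ln x / 2) (s * pi / 2)"
    unfolding v_def by (rule csqrt_square) (use b in simp)
  have d: "csqrt v - of_real T = Complex (ln x / 2) (s * pi / 2)"
    unfolding c by (simp add: complex_eq_iff)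
  have "exp (ln x / 2) = sqrt x"
    using x ln_sqrt[of x, symmetric] by (simp add: exp_ln)
  then show "exp (csqrt v - of_real T) = of_real s * \<i> * of_real (sqrt x)"
    unfolding d using s by (auto simp: complex_eq_iff Re_exp Im_exp)
  show "Re v = (T + ln x / 2)\<^sup>2 - pi\<^sup>2 / 4" "Im v = s * pi * (T + ln x / 2)"
    using s by (auto simp: v_def power2_eq_square)
qed

text \<open>With b = T + ln x / 2, taking logarithms gives \<open>csqrt u\<close> = b + (2n+1) i
  pi/2 for an integer n, hence Im u = (2n+1) pi b. The strip leaves only n = 0 and n = -1. The half
  height 2 pi b of Gamma separates this pair from the next one.\<close>

lemma f_int_denominator_zero_in_strip:
  assumes x: "0 < x" and b: "0 < T + ln x / 2"
      and Im: "\<bar>Im u\<bar> < 3 * pi * (T + ln x / 2)"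
      and zero: "exp (2 * (csqrt u - of_real T)) + of_real x = 0"
  shows "\<exists>s\<in>{1, -1}. u = (Complex (T + ln x / 2) (s * pi / 2))\<^sup>2"
proof -
  let ?b = "T + ln x / 2"
  have "exp (Complex (ln x) pi) = - of_real x"
    using x by (simp add: complex_eq_iff Re_exp Im_exp)
  moreover have "exp (2 * (csqrt u - of_real T)) = - of_real x"
    using zero by (simp only: eq_neg_iff_add_eq_0)
  ultimately have "exp (2 * (csqrt u - of_real T)) = exp (Complex (ln x) pi)"
    by (simp only:)
  then obtain n :: int where n: "2 * (csqrt u - of_real T) = Complex (ln x) pi + (of_int (2 * n) * pi) * \<i>"
    using exp_eq by blast
  define w where "w = csqrt u"
  have w: "w = Complex ?b ((2 * of_int n + 1) * pi / 2)"
    using arg_cong[OF n, of Re] arg_cong[OF n, of Im] unfolding w_def [symmetric]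
    by (simp add: complex_eq_iff algebra_simps)
  have u: "u = (Complex ?b ((2 * of_int n + 1) * pi / 2))\<^sup>2"
    using power2_csqrt[of u] unfolding w_def [symmetric] w by simp
  have "Im u = (2 * of_int n + 1) * (pi * ?b)"
    by (simp add: u power2_eq_square)
  then have "\<bar>2 * of_int n + 1 :: real\<bar> * (pi * ?b) < 3 * (pi * ?b)"
    using Im b by (simp add: abs_mult)
  then have "\<bar>2 * of_int n + 1 :: real\<bar> < 3"
    by (rule mult_right_less_imp_less) (use b in simp)
  then have "n = 0 \<or> n = -1" by linarith
  then show ?thesis using u by auto
qed

lemma f_int_holomorphic:
  assumes "S \<subseteq> {u. 0 < Re u}"
      and "\<And>u. u \<in> S \<Longrightarrow> exp (2 * (csqrt u - of_real T)) + complex_of_real x \<noteq> 0"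
  shows "(\<lambda>u. f_int T u x) holomorphic_on S"
proof -
  have "u \<notin> \<real>\<^sub>\<le>\<^sub>0" "csqrt u \<noteq> 0" if "u \<in> S" for u
    using assms(1) that by (auto simp: complex_nonpos_Reals_iff)
  then show ?thesis unfolding f_int_def
    by (intro holomorphic_intros) (use assms(2) in auto)
qed

section \<open>The integral along the real segment and its truncation error\<close>

text \<open>On the positive axis the integrand has the antiderivative (2 sqrt x / pi)
  arctan(exp(sqrt y - T) / sqrt x).\<close>

lemma contour_integral_f_int_real_segment:
  assumes x: "0 < x" and R: "1 < R"
  shows "contour_integral (linepath (Complex 1 0) (Complex R 0)) (\<lambda>u. f_int T u x) =
     of_real (2 * sqrt x / pi * (arctan (exp (sqrt R - T) / sqrt x) - arctan (exp (1 - T) / sqrt x)))"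
proof -
  define G where "G = (\<lambda>y. 2 * sqrt x / pi * arctan (exp (sqrt y - T) / sqrt x))"
  have alg: "2 * r / pi * (inverse (E / x) * (e * (inverse w / 2) / r)) = x / pi * (1 / w) * (e / E)"
    if "0 < r" "0 < E" "0 < w" for r E w e :: real
    using that x by (simp add: field_simps)
  have "((\<lambda>y. quadrature_integrand T y x) has_integral (G R - G 1)) {1..R}"
  proof (rule fundamental_theorem_of_calculus)
    show "1 \<le> R" using R by simp
    fix y assume "y \<in> {1..R}"
    then have y: "0 < y" by simp
    have q: "1 + (exp (sqrt y - T) / sqrt x)\<^sup>2 = (exp (2 * (sqrt y - T)) + x) / x"
      unfolding exp_double using x by (simp add: field_simps)
    have "(G has_real_derivative 2 * sqrt x / pi * (inverse (1 + (exp (sqrt y - T) / sqrt x)\<^sup>2)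
             * (exp (sqrt y - T) * (inverse (sqrt y) / 2) / sqrt x))) (at y)"
      unfolding G_def by (rule derivative_eq_intros refl | use x y in simp)+
    also have "2 * sqrt x / pi * (inverse (1 + (exp (sqrt y - T) / sqrt x)\<^sup>2)
             * (exp (sqrt y - T) * (inverse (sqrt y) / 2) / sqrt x)) = quadrature_integrand T y x"
      unfolding q quadrature_integrand_def using x y by (intro alg) (auto intro: add_pos_pos)
    finally show "(G has_vector_derivative quadrature_integrand T y x) (at y within {1..R})"
      by (simp add: has_real_derivative_iff_has_vector_derivative has_vector_derivative_at_within)
  qed
  then have "((\<lambda>y. complex_of_real (quadrature_integrand T y x)) has_integral of_real (G R - G 1)) {1..R}"
    by (rule has_integral_of_real)
  then have "((\<lambda>y. f_int T (of_real y) x) has_integral of_real (G R - G 1)) {1..R}"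
    by (rule has_integral_eq[rotated]) (simp add: f_int_of_real)
  then have "((\<lambda>u. f_int T u x) has_contour_integral of_real (G R - G 1)) (linepath (Complex 1 0) (Complex R 0))"
    using R by (subst has_contour_integral_linepath_Reals_iff) (auto simp: complex_is_Real_iff)
  then show ?thesis
    by (simp add: contour_integral_unique G_def right_diff_distrib)
qed

text \<open>Over the whole line the arctangent would increase by pi/2, giving exactly sqrt x. The
  missing pieces are arctan(sqrt x / c) and arctan(d / sqrt x), each bounded by its argument: the
  truncations at the upper and the lower end.\<close>

lemma arctan_difference_bound:
  assumes x: "0 < x" "x \<le> 1" and c: "0 < c" and d: "0 < d"
  shows "\<bar>2 * sqrt x / pi * (arctan (c / sqrt x) - arctan (d / sqrt x)) - sqrt x\<bar> \<le> 1 / c + d"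
proof -
  have sx: "0 < sqrt x" using x by simp
  have inv: "pi / 2 - arctan (c / sqrt x) = arctan (sqrt x / c)"
    using arctan_inverse[of "c / sqrt x"] sx c by (simp add: sgn_if)
  have "2 * sqrt x / pi * (arctan (c / sqrt x) - arctan (d / sqrt x)) - sqrt x
      = - (2 * sqrt x / pi * (arctan (sqrt x / c) + arctan (d / sqrt x)))"
    unfolding inv [symmetric] by (simp add: field_simps)
  moreover have "0 \<le> 2 * sqrt x / pi * (arctan (sqrt x / c) + arctan (d / sqrt x))"
    using sx c d by (intro mult_nonneg_nonneg add_nonneg_nonneg) auto
  moreover have "2 * sqrt x / pi * (arctan (sqrt x / c) + arctan (d / sqrt x))
      \<le> 2 * sqrt x / pi * (sqrt x / c + d / sqrt x)"
    using sx c d by (intro mult_left_mono add_mono arctan_le_self) auto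
  moreover have "2 * sqrt x / pi * (sqrt x / c + d / sqrt x) = 2 / pi * (x / c + d)"
    using sx by (simp add: field_simps)
  moreover have "2 / pi * (x / c + d) \<le> 1 * (1 / c + d)"
    using x c d pi_ge_two by (intro mult_mono add_mono divide_right_mono) auto
  ultimately show ?thesis by simp
qed

section \<open>Residues in rectangles and at the quadrature nodes\<close>

text \<open>The winding number is 1 inside and 0 outside. Points of \<open>pts\<close> outside the
  rectangle drop out, so one set of singularities serves both half rectangles.\<close>

lemma Residue_theorem_rectpath:
  assumes S: "open S" "connected S" "finite pts" "f holomorphic_on S - pts"
      and PQ: "Re P < Re Q" "Im P < Im Q" "cbox P Q \<subseteq> S"
      and pts: "pts \<inter> path_image (rectpath P Q) = {}"
  shows "contour_integral (rectpath P Q) f = 2 * pi * \<i> * (\<Sum>p\<in>pts \<inter> box P Q. residue f p)"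
proof -
  have out: "winding_number (rectpath P Q) z = 0" if "z \<notin> cbox P Q" for z
    by (rule winding_number_rectpath_outside) (use PQ that in auto)
  have "contour_integral (rectpath P Q) f
      = 2 * pi * \<i> * (\<Sum>p\<in>pts. winding_number (rectpath P Q) p * residue f p)"
    using S PQ pts path_image_rectpath_subset_cbox[of P Q]
    by (intro Residue_theorem[of S]) (auto intro!: out)
  also have "(\<Sum>p\<in>pts. winding_number (rectpath P Q) p * residue f p)
      = (\<Sum>p\<in>pts \<inter> box P Q. winding_number (rectpath P Q) p * residue f p)"
  proof (rule sum.mono_neutral_right)
    show "\<forall>p\<in>pts - pts \<inter> box P Q. winding_number (rectpath P Q) p * residue f p = 0"
      using pts PQ path_image_rectpath_cbox_minus_box[of P Q] by (auto intro!: out)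
  qed (use S in auto)
  also have "\<dots> = (\<Sum>p\<in>pts \<inter> box P Q. residue f p)"
    by (intro sum.cong refl) (simp add: winding_number_rectpath)
  finally show ?thesis .
qed

lemma m_fn_holomorphic:
  assumes "\<And>u. u \<in> S \<Longrightarrow> sin (of_real pi * u / of_real h) \<noteq> 0"
  shows "m_fn h holomorphic_on S"
proof -
  have "(\<lambda>u. - (\<i> / 2) * (cos (of_real pi * u / of_real h) / sin (of_real pi * u / of_real h))) holomorphic_on S"
    \<comment> \<open>For h = 0 the quotient by h defaults to 0, so the assumption forces S to be
      empty.\<close>
    using assms by (cases "h = 0") (auto intro!: holomorphic_intros)
  then show ?thesis by (simp add: m_fn_def cot_def fun_eq_iff cong: holomorphic_cong)
qed

lemma sin_pi_times_over_eq_0_iff: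
  fixes u :: complex
  assumes "h \<noteq> 0"
  shows "sin (of_real pi * u / of_real h) = 0 \<longleftrightarrow> (\<exists>n::int. u = of_real (of_int n * h))"
proof -
  have "of_real pi * u / of_real h = of_real (of_int n * pi) \<longleftrightarrow> u = of_real (of_int n * h)" for n :: int
    using assms by (auto simp: field_simps)
  then show ?thesis by (simp only: sin_eq_0)
qed

text \<open>\<open>m_fn\<close> is -(i/2) cos / sin, and at a node the sine has derivative (pi / h)
  cos, so the cosines cancel. Multiplied by 2 pi i the residue becomes h times the sampled
  integrand, a term of the trapezoidal sum.\<close>

lemma residue_f_int_m_fn_node:
  assumes x: "0 < x" and b: "0 < T + ln x / 2" and h: "0 < h" and j: "0 < (j::nat)"
  shows "residue (\<lambda>u. f_int T u x * m_fn h u) (of_real (real j * h))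
     = - (\<i> * of_real h / (2 * of_real pi)) * of_real (quadrature_integrand T (real j * h) x)"
proof -
  define f where "f = (\<lambda>u. f_int T u x)"
  define c where "c = (\<lambda>u. cos (of_real pi * u / of_real h :: complex))"
  \<comment> \<open>The poles of \<open>f_int\<close> have |Im u| = pi (T + ln x / 2) or more, so
    this open half strip avoids them all.\<close>
  define S where "S = {u. 0 < Re u} \<inter> ({u. - (pi * (T + ln x / 2)) < Im u} \<inter> {u. Im u < pi * (T + ln x / 2)})"
  let ?y = "complex_of_real (real j * h)"
  have arg: "of_real pi * ?y / of_real h = of_real (pi * j)" using h by simp
  have cy: "c ?y \<noteq> 0"
  proof -
    have "c ?y = of_real (cos (pi * j))" unfolding c_def arg by (simp only: cos_of_real)
    then show ?thesis by (simp add: mult.commute)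
  qed
  have fy: "f ?y = of_real (quadrature_integrand T (real j * h) x)"
    unfolding f_def using h by (intro f_int_of_real) simp
  have "residue (\<lambda>u. (f u * (- (\<i> / 2)) * c u) / sin (of_real pi * u / of_real h)) ?y
      = (f ?y * (- (\<i> / 2)) * c ?y) / (c ?y * (of_real pi / of_real h))"
  proof (rule residue_simple_pole_deriv[of _ S])
    have "f holomorphic_on S" unfolding f_def
    proof (rule f_int_holomorphic)
      fix u assume u: "u \<in> S"
      show "exp (2 * (csqrt u - of_real T)) + complex_of_real x \<noteq> 0"
      proof
        assume z: "exp (2 * (csqrt u - of_real T)) + complex_of_real x = 0"
        have pb: "0 < pi * (T + ln x / 2)" using b by simp
        have "\<bar>Im u\<bar> < 3 * pi * (T + ln x / 2)" using u pb unfolding S_def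
          by (auto simp: mult.assoc)
        from f_int_denominator_zero_in_strip[OF x b this z] obtain s where
          s: "s = 1 \<or> s = -1" "u = (Complex (T + ln x / 2) (s * pi / 2))\<^sup>2" by blast
        then have "Im u = s * pi * (T + ln x / 2)" using Im_f_int_pole[OF x b s(1)] by simp
        then show False using u s(1) unfolding S_def by auto
      qed
    qed (auto simp: S_def)
    then show "(\<lambda>u. f u * (- (\<i> / 2)) * c u) holomorphic_on S"
      unfolding c_def using h by (intro holomorphic_intros) auto
    show "(\<lambda>u. sin (of_real pi * u / of_real h)) holomorphic_on S"
      using h by (intro holomorphic_intros) auto
    show "open S" unfolding S_def
      by (intro open_Int open_halfspace_Re_gt open_halfspace_Im_gt open_halfspace_Im_lt)
    show "connected S" unfolding S_def
      by (intro convex_connected convex_Int convex_halfspace_Re_gt convex_halfspace_Im_gt convex_halfspace_Im_lt)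
    show "?y \<in> S" unfolding S_def using h j b by simp
    show "((\<lambda>u. sin (of_real pi * u / of_real h)) has_field_derivative c ?y * (of_real pi / of_real h)) (at ?y)"
      unfolding c_def using h by (auto intro!: derivative_eq_intros)
    show "f ?y * (- (\<i> / 2)) * c ?y \<noteq> 0"
      using cy fy quadrature_integrand_pos[of "real j * h" x T] x h j by simp
    show "sin (of_real pi * ?y / of_real h) = 0"
      using h by (subst sin_pi_times_over_eq_0_iff) (auto intro!: exI[of _ "int j"])
    show "c ?y * (of_real pi / of_real h) \<noteq> 0" using cy h by simp
  qed
  also have "(f ?y * (- (\<i> / 2)) * c ?y) / (c ?y * (of_real pi / of_real h)) =
      - (\<i> * of_real h / (2 * of_real pi)) * of_real (quadrature_integrand T (real j * h) x)"
    unfolding fy using cy h by (simp add: field_simps)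
  also have "(\<lambda>u. (f u * (- (\<i> / 2)) * c u) / sin (of_real pi * u / of_real h)) = (\<lambda>u. f_int T u x * m_fn h u)"
    by (auto simp: f_def c_def m_fn_def cot_def)
  finally show ?thesis .
qed

section \<open>The trapezoidal error as a contour integral\<close>

text \<open>The constant 12 is 8 + 1 + 3: the two poles of \<open>f_int\<close> contribute 8
  exp(-T), the truncation at the right end exp(-T), and the one at u = 1 at most 3 exp(-T).\<close>

lemma trapezoidal_error_le_contour_integral:
  fixes T x h :: real and n :: nat
  assumes h_eq: "h = 2 * pi\<^sup>2" and T: "0 < T" "4 * T\<^sup>2 = real n * h"
      and x: "exp (4 - 2 * T) \<le> x" "x \<le> 1"
  shows "\<bar>h * (\<Sum>j=1..n. quadrature_integrand T (real j * h) x) - sqrt x\<bar>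
     \<le> cmod (contour_integral (Gamma_path T x) (\<lambda>u. f_int T u x * delta_fn h u)) + 12 * exp (- T)"
proof -
  define b where "b = T + ln x / 2"
  define a where "a = 2 * pi * b"
  define R where "R = 4 * T\<^sup>2 + 1"
  define f where "f = (\<lambda>u. f_int T u x)"
  define v where "v = (\<lambda>s::real. (Complex b (s * pi / 2))\<^sup>2)"
  define J where "J = (\<lambda>j::nat. complex_of_real (real j * h)) ` {1..n}"
  \<comment> \<open>An open box around Gamma that stops at the second pair of poles of
    \<open>f_int\<close> and strictly between 0 and (n+1) h, so the only nodes in it are those with
    index 1 to n. It contains the right side Re u = n h + 1 because h > 1.\<close>
  define S where "S = box (Complex 0 (- (3 * pi * b))) (Complex (real (n + 1) * h) (3 * pi * b))"
  have "1 < pi\<^sup>2" using pi_gt3 by (intro one_less_power) auto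
  then have h: "1 < h" "h = 2 * pi\<^sup>2" unfolding h_eq by linarith+
  have x0: "0 < x" using x(1) exp_gt_zero[of "4 - 2 * T"] by linarith
  \<comment> \<open>The lower bound on x yields b >= 2. This pushes the poles, whose real part is
    b^2 - pi^2/4, to the right of Re u = 1, and makes the cotangent estimate applicable.\<close>
  have "4 - 2 * T \<le> ln x" using x(1) x0 by (simp add: ln_ge_iff)
  then have b2: "2 \<le> b" by (simp add: b_def)
  have bT: "b \<le> T" using x x0 by (simp add: b_def)
  have b0: "0 < T + ln x / 2" using b2 by (simp add: b_def)
  have pb: "0 < pi * b" using b2 by simp
  have R1: "1 < R" using T(1) by (simp add: R_def)
  have Rn: "R = real n * h + 1" using T by (simp add: R_def)
  have v_eq: "v s = (Complex b (s * pi / 2))\<^sup>2" for s by (simp add: v_def)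
  note pole = f_int_pole[OF x0 b0, folded b_def, folded v_eq]
  have vIm: "Im (v s) = s * pi * b" if "s = 1 \<or> s = -1" for s using pole(4)[OF that] .
  have vRe: "1 < Re (v s)" "Re (v s) < R" if "s = 1 \<or> s = -1" for s
  proof -
    have "pi\<^sup>2 < 12"
    proof -
      have "pi < 3.2" using pi_approx by simp
      then have "pi\<^sup>2 < 3.2\<^sup>2" by (intro power_strict_mono) auto
      then show ?thesis by (simp add: power2_eq_square)
    qed
    moreover have "4 \<le> b\<^sup>2" "b\<^sup>2 \<le> T\<^sup>2"
      using power_mono[of 2 b 2] power_mono[of b T 2] b2 bT by simp_all
    moreover have "0 \<le> T\<^sup>2" "0 \<le> pi\<^sup>2" by auto
    moreover have "Re (v s) = b\<^sup>2 - pi\<^sup>2 / 4" using pole(3)[OF that] .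
    ultimately show "1 < Re (v s)" "Re (v s) < R"
      unfolding R_def by linarith+
  qed
  have vexp: "exp (csqrt (v s) - of_real T) = of_real s * \<i> * of_real (sqrt x)"
    if "s = 1 \<or> s = -1" for s using pole(2)[OF that] .
  have vroot: "exp (csqrt (v s) - of_real T) ^ 2 = - of_real x" if "s = 1 \<or> s = -1" for s
    unfolding vexp[OF that] using that x0
    by (auto simp: power_mult_distrib simp flip: of_real_power)
  have v12: "v 1 \<noteq> v (-1)" using vIm[of 1] vIm[of "-1"] pb by auto

  have S: "open S" "connected S"
    unfolding S_def by (auto intro: convex_connected)
  have Spos: "0 < Re u" "\<bar>Im u\<bar> < 3 * pi * b" "Re u < real (n + 1) * h" if "u \<in> S" for u
    using that unfolding S_def by (auto simp: in_box_complex_iff)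
  have fS: "f holomorphic_on S - {v 1, v (-1)}" unfolding f_def
  proof (rule f_int_holomorphic)
    show "exp (2 * (csqrt u - of_real T)) + complex_of_real x \<noteq> 0" if "u \<in> S - {v 1, v (-1)}" for u
      using f_int_denominator_zero_in_strip[OF x0 b0, folded b_def, of u] that Spos[of u]
      unfolding v_def by blast
  qed (use Spos in auto)
  have mS: "m_fn h holomorphic_on S - J"
  proof (rule m_fn_holomorphic)
    fix u assume u: "u \<in> S - J"
    show "sin (of_real pi * u / of_real h) \<noteq> 0"
    proof
      assume "sin (of_real pi * u / of_real h) = 0"
      then obtain k :: int where k: "u = of_real (of_int k * h)"
        using sin_pi_times_over_eq_0_iff[of h u] h by auto
      have "0 < of_int k * h" "of_int k * h < real (n + 1) * h"
        using Spos[of u] u by (auto simp: k)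
      then have "0 < k" "k < int (n + 1)"
        using h by (auto simp: zero_less_mult_iff)
      then have "u = of_real (real (nat k) * h)" "nat k \<in> {1..n}" by (auto simp: k)
      then have "u \<in> J" unfolding J_def by blast
      with u show False by simp
    qed
  qed
  have rectS: "cbox (Complex 1 s) (Complex R t) \<subseteq> S" if "\<bar>s\<bar> \<le> a" "\<bar>t\<bar> \<le> a" for s t
    using that pb h by (auto simp: S_def in_box_complex_iff in_cbox_complex_iff a_def Rn algebra_simps)
  have Jbox: "J \<subseteq> box (Complex 1 (-a)) (Complex R a)"
  proof -
    have "1 < real j * h" "real j * h < real n * h + 1" if "Suc 0 \<le> j" "j \<le> n" for j
    proof -
      have "1 * h \<le> real j * h" "real j * h \<le> real n * h"
        using that h(1) by (intro mult_right_mono; simp)+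
      then show "1 < real j * h" "real j * h < real n * h + 1" using h(1) by linarith+
    qed
    then show ?thesis using b2 unfolding J_def
      by (auto simp: in_box_complex_iff Rn a_def)
  qed
  have vbox: "v s \<in> box (Complex 1 (-a)) (Complex R a)" if "s = 1 \<or> s = -1" for s
    using vRe[OF that] vIm[OF that] that b2 by (auto simp: in_box_complex_iff a_def)
  have a0: "0 < a" using pb by (simp add: a_def)

  \<comment> \<open>Residue evaluation over the two half rectangles and over Gamma\<close>
  have upper: "contour_integral (rectpath (Complex 1 0) (Complex R a)) f = 2 * pi * \<i> * residue f (v 1)"
  proof -
    have "{v 1, v (-1)} \<inter> box (Complex 1 0) (Complex R a) = {v 1}"
      using vbox[of 1] vIm[of 1] vIm[of "-1"] pb by (auto simp: in_box_complex_iff)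
    moreover have "{v 1, v (-1)} \<inter> path_image (rectpath (Complex 1 0) (Complex R a)) = {}"
      using a0 R1 vbox[of 1] vIm[of 1] vIm[of "-1"] pb
      by (subst path_image_rectpath) (auto simp: in_box_complex_iff)
    ultimately show ?thesis
      using Residue_theorem_rectpath[OF S _ fS, of "Complex 1 0" "Complex R a"] rectS[of 0 a] a0 R1 by simp
  qed
  have lower: "contour_integral (rectpath (Complex 1 (-a)) (Complex R 0)) f = 2 * pi * \<i> * residue f (v (-1))"
  proof -
    have "{v 1, v (-1)} \<inter> box (Complex 1 (-a)) (Complex R 0) = {v (-1)}"
      using vbox[of "-1"] vIm[of 1] vIm[of "-1"] pb by (auto simp: in_box_complex_iff)
    moreover have "{v 1, v (-1)} \<inter> path_image (rectpath (Complex 1 (-a)) (Complex R 0)) = {}"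
      using a0 R1 vbox[of "-1"] vIm[of 1] vIm[of "-1"] pb
      by (subst path_image_rectpath) (auto simp: in_box_complex_iff)
    ultimately show ?thesis
      using Residue_theorem_rectpath[OF S _ fS, of "Complex 1 (-a)" "Complex R 0"] rectS[of "-a" 0] a0 R1 by simp
  qed
  let ?P = "rectpath (Complex 1 (-a)) (Complex R a)"
  have fm_hol: "(\<lambda>u. f u * m_fn h u) holomorphic_on S - ({v 1, v (-1)} \<union> J)"
    by (intro holomorphic_on_mult holomorphic_on_subset[OF fS] holomorphic_on_subset[OF mS]) auto
  have pts: "{v 1, v (-1)} \<union> J \<subseteq> box (Complex 1 (-a)) (Complex R a)"
    using vbox Jbox by simp
  have vJ: "{v 1, v (-1)} \<inter> J = {}"
    using vIm[of 1] vIm[of "-1"] pb by (auto simp: J_def)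
  have finJ: "finite J" by (simp add: J_def)
  have whole: "contour_integral ?P (\<lambda>u. f u * m_fn h u) =
      2 * pi * \<i> * (residue (\<lambda>u. f u * m_fn h u) (v 1) + residue (\<lambda>u. f u * m_fn h u) (v (-1))
         + (\<Sum>j=1..n. residue (\<lambda>u. f u * m_fn h u) (of_real (real j * h))))"
  proof -
    have "contour_integral ?P (\<lambda>u. f u * m_fn h u) = 2 * pi * \<i> *
        (\<Sum>p\<in>({v 1, v (-1)} \<union> J) \<inter> box (Complex 1 (-a)) (Complex R a). residue (\<lambda>u. f u * m_fn h u) p)"
    proof (rule Residue_theorem_rectpath[OF S _ fm_hol])
      show "({v 1, v (-1)} \<union> J) \<inter> path_image ?P = {}"
        using pts path_image_rectpath_inter_box[of "Complex 1 (-a)" "Complex R a"] a0 R1 by auto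
    qed (use finJ a0 R1 rectS[of "-a" a] in auto)
    also have "({v 1, v (-1)} \<union> J) \<inter> box (Complex 1 (-a)) (Complex R a) = {v 1, v (-1)} \<union> J"
      using pts by blast
    also have "(\<Sum>p\<in>{v 1, v (-1)} \<union> J. residue (\<lambda>u. f u * m_fn h u) p) =
        (\<Sum>p\<in>{v 1, v (-1)}. residue (\<lambda>u. f u * m_fn h u) p) + (\<Sum>p\<in>J. residue (\<lambda>u. f u * m_fn h u) p)"
      using vJ finJ by (intro sum.union_disjoint) auto
    also have "(\<Sum>p\<in>{v 1, v (-1)}. residue (\<lambda>u. f u * m_fn h u) p)
        = residue (\<lambda>u. f u * m_fn h u) (v 1) + residue (\<lambda>u. f u * m_fn h u) (v (-1))"
      using v12 by simp
    also have "(\<Sum>p\<in>J. residue (\<lambda>u. f u * m_fn h u) p)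
        = (\<Sum>j=1..n. residue (\<lambda>u. f u * m_fn h u) (of_real (real j * h)))"
      unfolding J_def using h by (subst sum.reindex) (auto simp: inj_on_def)
    finally show ?thesis .
  qed

  \<comment> \<open>Residues at the two poles of the integrand\<close>
  have res_f: "residue f (v s) = - (of_real s * \<i> * of_real (sqrt x) / of_real pi)" if s: "s = 1 \<or> s = -1" for s
    using residue_f_int_times[OF x0 open_halfspace_Re_gt connected_halfspace_Re_gt subset_refl _ vroot[OF s], of "\<lambda>_. 1"]
      vRe[OF s] vexp[OF s] by (simp add: f_def)
  have res_fm: "residue (\<lambda>u. f u * m_fn h u) (v s) = residue f (v s) * m_fn h (v s)" if s: "s = 1 \<or> s = -1" for s
  proof -
    \<comment> \<open>The open quadrant containing \<open>v s\<close> avoids the real axis and hence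
      all poles of \<open>m_fn\<close>.\<close>
    define H where "H = {u. 0 < Re u} \<inter> {u. 0 < s * Im u}"
    have H: "H = {u. 0 < Re u} \<inter> {u. 0 < Im u} \<or> H = {u. 0 < Re u} \<inter> {u. Im u < 0}"
      using s by (auto simp: H_def)
    then have "open H" "connected H"
      by (auto intro!: convex_connected convex_Int open_Int open_halfspace_Re_gt open_halfspace_Im_gt
          open_halfspace_Im_lt convex_halfspace_Re_gt convex_halfspace_Im_gt convex_halfspace_Im_lt)
    have "v s \<in> H" using vRe[OF s] vIm[OF s] s pb by (auto simp: H_def)
    have nr: "u \<notin> \<real>" if "u \<in> H" for u using that s by (auto simp: H_def complex_is_Real_iff)
    have "m_fn h holomorphic_on H"
    proof (rule m_fn_holomorphic)
      show "sin (of_real pi * u / of_real h) \<noteq> 0" if "u \<in> H" for u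
        using nr[OF that] h sin_pi_times_over_eq_0_iff[of h u] by auto
    qed
    have "m_fn h (v s) \<noteq> 0"
    proof -
      \<comment> \<open>All zeros of sine and cosine are real, so \<open>m_fn\<close> is nonzero off
        the real axis.\<close>
      define z where "z = of_real pi * v s / of_real h"
      have "Im z \<noteq> 0" unfolding z_def using vIm[OF s] s pb h by auto
      then have "sin z \<noteq> 0" "cos z \<noteq> 0"
        unfolding sin_eq_0 cos_eq_0 by auto
      then show ?thesis by (simp add: m_fn_def cot_def z_def)
    qed
    have "residue (\<lambda>u. f u * m_fn h u) (v s) = - (exp (csqrt (v s) - of_real T) / of_real pi) * m_fn h (v s)"
      unfolding f_def
      by (rule residue_f_int_times[OF x0 \<open>open H\<close> \<open>connected H\<close> _ \<open>v s \<in> H\<close> vroot[OF s]])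
         (use \<open>m_fn h holomorphic_on H\<close> \<open>m_fn h (v s) \<noteq> 0\<close> in \<open>auto simp: H_def\<close>)
    then show ?thesis unfolding res_f[OF s] vexp[OF s] .
  qed

  define q where "q = (\<lambda>j. quadrature_integrand T (real j * h) x)"
  define I where "I = 2 * sqrt x / pi * (arctan (exp (sqrt R - T) / sqrt x) - arctan (exp (1 - T) / sqrt x))"
  have nodes: "(\<Sum>j=1..n. residue (\<lambda>u. f u * m_fn h u) (of_real (real j * h)))
      = - (\<i> * of_real h / (2 * of_real pi)) * of_real (\<Sum>j=1..n. q j)"
    unfolding f_def q_def of_real_sum sum_distrib_left
    using h by (intro sum.cong refl residue_f_int_m_fn_node[OF x0 b0]) auto
  have Gamma: "Gamma_path T x = ?P"
    by (simp add: Gamma_path_def rectpath_def Let_def a_def b_def R_def)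
  have bdy: "path_image ?P \<subseteq> S - ({v 1, v (-1)} \<union> J)"
    using pts path_image_rectpath_cbox_minus_box[of "Complex 1 (-a)" "Complex R a"] rectS[of "-a" a] a0 R1
    by auto
  have seg: "closed_segment (Complex 1 0) (Complex R 0) \<subseteq> S - {v 1, v (-1)}"
  proof -
    have "closed_segment (Complex 1 0) (Complex R 0) \<subseteq> cbox (Complex 1 (-a)) (Complex R a)"
      using a0 R1 by (auto simp: closed_segment_same_Im closed_segment_eq_real_ivl in_cbox_complex_iff)
    moreover have "Im u = 0" if "u \<in> closed_segment (Complex 1 0) (Complex R 0)" for u
      using that by (auto simp: closed_segment_same_Im)
    ultimately show ?thesis using rectS[of "-a" a] a0 vIm[of 1] vIm[of "-1"] pb by auto
  qed
  have cont: "continuous_on (path_image ?P \<union> closed_segment (Complex 1 0) (Complex R 0)) f"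
    by (rule continuous_on_subset[OF holomorphic_on_imp_continuous_on[OF fS]]) (use bdy seg in auto)
  have segI: "contour_integral (linepath (Complex 1 0) (Complex R 0)) f = of_real I"
    unfolding f_def I_def by (rule contour_integral_f_int_real_segment[OF x0 R1])
  have fm: "((\<lambda>u. f u * m_fn h u) has_contour_integral contour_integral ?P (\<lambda>u. f u * m_fn h u)) ?P"
    by (intro has_contour_integral_integral contour_integrable_holomorphic_simple[OF fm_hol])
       (use S finJ bdy in \<open>auto intro!: open_Diff finite_imp_closed\<close>)
  have "((\<lambda>u. f u * mu_fn u - f u * m_fn h u) has_contour_integral
      (of_real I + contour_integral (rectpath (Complex 1 (-a)) (Complex R 0)) f / 2
        - contour_integral (rectpath (Complex 1 0) (Complex R a)) f / 2)
        - contour_integral ?P (\<lambda>u. f u * m_fn h u)) ?P"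
    using has_contour_integral_diff[OF contour_integral_rectpath_sign_jump[OF a0 _ cont] fm] R1
    unfolding segI by simp
  moreover have "(\<lambda>u. f_int T u x * delta_fn h u) = (\<lambda>u. f u * mu_fn u - f u * m_fn h u)"
    by (simp add: f_def delta_fn_def right_diff_distrib)
  ultimately have ci: "contour_integral (Gamma_path T x) (\<lambda>u. f_int T u x * delta_fn h u) =
      (of_real I + contour_integral (rectpath (Complex 1 (-a)) (Complex R 0)) f / 2
        - contour_integral (rectpath (Complex 1 0) (Complex R a)) f / 2)
        - contour_integral ?P (\<lambda>u. f u * m_fn h u)"
    unfolding Gamma by (simp only: contour_integral_unique)

  \<comment> \<open>Collecting the error terms\<close>
  \<comment> \<open>\<open>d1\<close> and \<open>d2\<close> are the values of
    \<open>delta_fn\<close> at the upper and lower pole. The half-rectangle residues and those of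
    the product with \<open>m_fn\<close> combine to 2 pi i times the sum of the residues of f
    weighted by these values.\<close>
  define d1 where "d1 = - 1/2 + (\<i>/2) * cot (of_real pi * v 1 / of_real h)"
  define d2 where "d2 = 1/2 + (\<i>/2) * cot (of_real pi * v (-1) / of_real h)"
  define r where "r = complex_of_real (sqrt x / pi)"
  have r1: "residue f (v 1) = - \<i> * r" and r2: "residue f (v (-1)) = \<i> * r"
    using res_f[of 1] res_f[of "-1"] by (auto simp: r_def)
  have m1: "m_fn h (v 1) = - d1 - 1/2" and m2: "m_fn h (v (-1)) = 1/2 - d2"
    by (auto simp: m_fn_def d1_def d2_def)
  have "contour_integral (Gamma_path T x) (\<lambda>u. f_int T u x * delta_fn h u)
      = of_real I - of_real (h * (\<Sum>j=1..n. q j)) + 2 * of_real pi * \<i> * (\<i> * r * (d2 - d1))"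
    unfolding ci upper lower whole nodes res_fm[of 1, simplified] res_fm[of "-1", simplified] r1 r2 m1 m2
    by (simp add: field_simps)
  then have main: "of_real (h * (\<Sum>j=1..n. q j) - I) =
      2 * of_real pi * \<i> * (\<i> * r * (d2 - d1))
      - contour_integral (Gamma_path T x) (\<lambda>u. f_int T u x * delta_fn h u)"
    by simp
  \<comment> \<open>Here the choice h = 2 pi^2 enters: scaling by pi / h turns Im v = s pi b into s
    b / 2, the height at which the cotangent estimate gives exp(-b).\<close>
  have Imv: "Im (of_real pi * v s / of_real h) = s * b / 2" if "s = 1 \<or> s = -1" for s
    using vIm[OF that] by (simp add: h(2) power2_eq_square)
  have "cmod d1 \<le> 2 * exp (- b)" "cmod d2 \<le> 2 * exp (- b)"
    unfolding d1_def d2_def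
    using norm_half_plus_cot_le[of b] b2 Imv[of 1] Imv[of "-1"] by auto
  then have dd: "cmod (d2 - d1) \<le> 4 * exp (- b)"
    using norm_triangle_ineq4[of d2 d1] by linarith
  \<comment> \<open>The factor sqrt x of the residues compensates exp(-b) = exp(-T) / sqrt x, so the
    bound is uniform in x.\<close>
  have eb: "sqrt x * exp (- b) = exp (- T)"
  proof -
    have "exp (ln x / 2) = sqrt x" using x0 ln_sqrt[of x, symmetric] by (simp add: exp_ln)
    then have "sqrt x * exp (- b) = exp (ln x / 2 + - b)" by (simp only: exp_add)
    then show ?thesis by (simp add: b_def)
  qed
  have "cmod (2 * of_real pi * \<i> * (\<i> * r * (d2 - d1))) = 2 * sqrt x * cmod (d2 - d1)"
    using x0 by (simp add: norm_mult r_def norm_divide)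
  also have "\<dots> \<le> 2 * sqrt x * (4 * exp (- b))"
    using dd x0 by (intro mult_left_mono) auto
  finally have E: "cmod (2 * of_real pi * \<i> * (\<i> * r * (d2 - d1))) \<le> 8 * exp (- T)"
    using eb by simp
  have "\<bar>h * (\<Sum>j=1..n. q j) - I\<bar> = cmod (of_real (h * (\<Sum>j=1..n. q j) - I))"
    by (simp only: norm_of_real)
  also have "\<dots> \<le> 8 * exp (- T) + cmod (contour_integral (Gamma_path T x) (\<lambda>u. f_int T u x * delta_fn h u))"
    unfolding main using E by (intro order_trans[OF norm_triangle_ineq4] add_mono) auto
  finally have 1: "\<bar>h * (\<Sum>j=1..n. q j) - I\<bar> \<le> \<dots>" .
  have "\<bar>I - sqrt x\<bar> \<le> 1 / exp (sqrt R - T) + exp (1 - T)"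
    unfolding I_def by (rule arctan_difference_bound) (use x0 x in auto)
  also have "1 / exp (sqrt R - T) \<le> exp (- T)"
  proof -
    have "2 * T \<le> sqrt R" using T by (intro real_le_rsqrt) (simp add: R_def power_mult_distrib)
    then have "exp T \<le> exp (sqrt R - T)" by simp
    then show ?thesis by (simp add: exp_minus field_simps)
  qed
  also have "exp (1 - T) \<le> 3 * exp (- T)"
    using exp_le by (simp add: exp_diff exp_minus field_simps)
  finally have "\<bar>I - sqrt x\<bar> \<le> 4 * exp (- T)" by simp
  with 1 show ?thesis unfolding q_def by linarith
qed

section \<open>The rational approximation\<close>

text \<open>A right-endpoint Riemann sum of the decreasing function exp(-sqrt y) / sqrt y, whose
  integral over the positive axis is 2.\<close>

lemma sum_exp_minus_sqrt_le:
  fixes h :: real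
  assumes h: "0 < h"
  shows "(\<Sum>j=1..n. h / sqrt (real j * h) * exp (- sqrt (real j * h))) \<le> 2"
proof -
  \<comment> \<open>The induction needs the partial integral -2 exp(-sqrt y) from 0 to n h as bound;
    each step then telescopes.\<close>
  have "(\<Sum>j=1..n. h / sqrt (real j * h) * exp (- sqrt (real j * h))) \<le> 2 - 2 * exp (- sqrt (real n * h))"
  proof (induction n)
    case 0
    then show ?case by simp
  next
    case (Suc n)
    define s where "s = sqrt (real n * h)"
    define t where "t = sqrt (real (Suc n) * h)"
    have s0: "0 \<le> s" and t0: "0 < t" and st: "s \<le> t"
      using h by (auto simp: s_def t_def)
    have "h = t\<^sup>2 - s\<^sup>2" using h by (simp add: s_def t_def algebra_simps)
    also have "\<dots> = (t + s) * (t - s)" by (simp add: power2_eq_square algebra_simps)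
    also have "\<dots> \<le> (2 * t) * (t - s)" using st by (intro mult_right_mono) auto
    finally have "h / t \<le> 2 * (t - s)" using t0 by (simp add: field_simps)
    also have "\<dots> \<le> 2 * (exp (t - s) - 1)"
      using exp_ge_add_one_self[of "t - s"] by (intro mult_left_mono) (simp_all add: algebra_simps)
    finally have "h / t * exp (- t) \<le> 2 * (exp (t - s) - 1) * exp (- t)"
      by (rule mult_right_mono) simp
    also have "\<dots> = 2 * exp (- s) - 2 * exp (- t)"
      by (simp add: algebra_simps flip: exp_add)
    finally show ?case using Suc.IH unfolding s_def t_def by simp
  qed
  then show ?thesis using exp_gt_zero[of "- sqrt (real n * h)"] by linarith
qed

text \<open>Dropping x from the denominator bounds the fraction by exp(T - sqrt y), after which the
  Riemann sum bound applies.\<close>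

lemma quadrature_sum_bounds:
  assumes h: "0 < h" and x: "0 \<le> x"
  shows "0 \<le> h * (\<Sum>j=1..n. quadrature_integrand T (real j * h) x)"
    and "h * (\<Sum>j=1..n. quadrature_integrand T (real j * h) x) \<le> x * exp T"
proof -
  have nonneg: "0 \<le> quadrature_integrand T y x" if "0 \<le> y" for y
    unfolding quadrature_integrand_def using x that by (intro mult_nonneg_nonneg divide_nonneg_nonneg) auto
  then show "0 \<le> h * (\<Sum>j=1..n. quadrature_integrand T (real j * h) x)"
    using h by (intro mult_nonneg_nonneg sum_nonneg) auto
  have le: "h * quadrature_integrand T y x \<le> x * exp T / pi * (h / sqrt y * exp (- sqrt y))" if "0 < y" for y
  proof -
    define s where "s = exp (sqrt y - T)"
    have s: "0 < s" by (simp add: s_def)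
    have "exp (2 * (sqrt y - T)) = s\<^sup>2" unfolding s_def by (rule exp_double)
    then have "h * quadrature_integrand T y x = h * (x / pi * (1 / sqrt y)) * (s / (s\<^sup>2 + x))"
      unfolding quadrature_integrand_def s_def by simp
    also have "\<dots> \<le> h * (x / pi * (1 / sqrt y)) * (1 / s)"
    proof (rule mult_left_mono)
      have "s / (s\<^sup>2 + x) \<le> s / s\<^sup>2"
        using s x by (intro divide_left_mono) (auto intro!: mult_pos_pos add_pos_nonneg)
      then show "s / (s\<^sup>2 + x) \<le> 1 / s" using s by (simp add: power2_eq_square)
    qed (use h x that in auto)
    also have "1 / s = exp T * exp (- sqrt y)"
      by (simp add: s_def exp_diff exp_minus field_simps)
    finally show ?thesis by (simp add: mult_ac)
  qed
  have "h * (\<Sum>j=1..n. quadrature_integrand T (real j * h) x)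
      \<le> (\<Sum>j=1..n. x * exp T / pi * (h / sqrt (real j * h) * exp (- sqrt (real j * h))))"
    unfolding sum_distrib_left using h by (intro sum_mono le) auto
  also have "\<dots> = x * exp T / pi * (\<Sum>j=1..n. h / sqrt (real j * h) * exp (- sqrt (real j * h)))"
    by (simp only: sum_distrib_left)
  also have "\<dots> \<le> x * exp T / pi * 2"
    using x by (intro mult_left_mono sum_exp_minus_sqrt_le h) auto
  also have "\<dots> = x * exp T * (2 / pi)" by simp
  also have "\<dots> \<le> x * exp T * 1"
    using x pi_ge_two by (intro mult_left_mono) auto
  finally show "h * (\<Sum>j=1..n. quadrature_integrand T (real j * h) x) \<le> x * exp T" by simp
qed

text \<open>Both terms lie between 0 and exp(4 - T), hence so does their distance.\<close>

lemma quadrature_error_near_zero: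
  assumes h: "0 < h" and x: "0 \<le> x" "x \<le> exp (4 - 2 * T)"
  shows "\<bar>h * (\<Sum>j=1..n. quadrature_integrand T (real j * h) x) - sqrt x\<bar> \<le> exp 4 * exp (- T)"
proof -
  have "x * exp T \<le> exp (4 - 2 * T) * exp T" using x by simp
  also have "\<dots> = exp 4 * exp (- T)" by (simp flip: exp_add)
  finally have 1: "x * exp T \<le> exp 4 * exp (- T)" .
  have "sqrt x \<le> sqrt ((exp (2 - T))\<^sup>2)"
    using x by (intro real_sqrt_le_mono) (simp flip: exp_double)
  also have "\<dots> \<le> exp 4 * exp (- T)" by (simp flip: exp_add)
  finally have "sqrt x \<le> exp 4 * exp (- T)" .
  moreover have "0 \<le> sqrt x" using x by simp
  ultimately show ?thesis
    using 1 quadrature_sum_bounds[OF h x(1), where n = n and T = T] by linarith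
qed

text \<open>Geometric series about the midpoint: on \<open>[0, 1]\<close> its ratio is at most \<open>(1/2) / (3/2)\<close>.\<close>

lemma simple_fraction_polynomial_approx:
  fixes q :: real
  assumes q: "1 \<le> q"
  shows "\<exists>p. degree p \<le> n \<and> (\<forall>x\<in>{0..1}. \<bar>x / (q + x) - poly p x\<bar> \<le> (1/3) ^ n / q)"
proof -
  define l where "l = [: 1 / 2 / (q + 1/2), - 1 / (q + 1/2) :]"
  \<comment> \<open>Since q + x = (q + 1/2)(1 - z) with z the value of \<open>l\<close> at x, this
    truncates the series of x / (q + x), with remainder x z^n / (q + x). The sum stops at k < n
    because the factor x adds one to the degree.\<close>
  define p where "p = smult (1 / (q + 1/2)) ([:0, 1:] * (\<Sum>k<n. l ^ k))"
  have "degree p \<le> n"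
  proof (cases n)
    case (Suc m)
    have dl: "degree l \<le> 1" unfolding l_def by simp
    have "degree (l ^ k) \<le> m" if "k < n" for k
    proof -
      have "degree (l ^ k) \<le> degree l * k" by (rule degree_power_le)
      also have "\<dots> \<le> 1 * k" by (rule mult_le_mono1[OF dl])
      also have "\<dots> \<le> m" using that Suc by simp
      finally show ?thesis .
    qed
    then have "degree (\<Sum>k<n. l ^ k) \<le> m" by (intro degree_sum_le) auto
    then have "degree ([:0, 1:] * (\<Sum>k<n. l ^ k)) \<le> Suc m"
      using degree_mult_le[of "[:0, 1:]" "\<Sum>k<n. l ^ k"] by simp
    then show ?thesis unfolding p_def Suc by (rule order_trans[OF degree_smult_le])
  qed (simp add: p_def)
  moreover have "\<bar>x / (q + x) - poly p x\<bar> \<le> (1/3) ^ n / q" if x: "x \<in> {0..1}" for x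
  proof -
    define z where "z = (1/2 - x) / (q + 1/2)"
    have z1: "1 - z = (q + x) / (q + 1/2)" using q by (simp add: z_def field_simps)
    have "1 - z \<noteq> 0" unfolding z1 using q x by simp
    then have z: "z \<noteq> 1" by auto
    have "poly l x = z" using q by (simp add: l_def z_def diff_divide_distrib)
    then have "poly p x = x / (q + 1/2) * (\<Sum>k<n. z ^ k)"
      by (simp add: p_def poly_sum poly_power)
    also have "(\<Sum>k<n. z ^ k) = (1 - z ^ n) / (1 - z)"
      using z by (simp add: sum_gp_strict)
    also have "x / (q + 1/2) * \<dots> = x * (1 - z ^ n) / (q + x)"
    proof -
      have "x / A * (w / (B / A)) = x * w / B" if "A \<noteq> 0" for A B w :: real
        using that by simp
      then show ?thesis unfolding z1 using q by simp
    qed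
    finally have "x / (q + x) - poly p x = x * z ^ n / (q + x)"
      by (simp add: diff_divide_distrib [symmetric] algebra_simps)
    then have "\<bar>x / (q + x) - poly p x\<bar> = x / (q + x) * \<bar>z\<bar> ^ n"
      using q x by (simp add: abs_mult power_abs)
    also have "\<dots> \<le> 1 / q * (1/3) ^ n"
    proof (intro mult_mono power_mono)
      show "x / (q + x) \<le> 1 / q" using q x by (intro frac_le) auto
      have "\<bar>1/2 - x\<bar> \<le> 1/2" using x by (auto simp: abs_if)
      then have "\<bar>1/2 - x\<bar> / (q + 1/2) \<le> (1/2) / (3/2)" using q by (intro frac_le) auto
      then show "\<bar>z\<bar> \<le> 1 / 3" using q by (simp add: z_def abs_divide)
    qed (use q x in auto)
    finally show ?thesis by simp
  qed
  ultimately show ?thesis by blast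
qed

text \<open>Each term of the trapezoidal sum is a multiple of x / (s_j^2 + x), with pole -s_j^2.
  Because 2 sqrt h is the constant \<open>sigma_c\<close>, these are the prescribed poles. Terms
  with j <= N are kept; for j > N one has s_j^2 >= 1 and a polynomial takes their place.\<close>

lemma quadrature_sum_rational:
  fixes N n :: nat and T h :: real
  assumes h: "h = 2 * pi\<^sup>2" and T: "T = sqrt (real N * h)" and n: "2 * T \<le> real n"
  shows "\<exists>a b. degree b \<le> n \<and> (\<forall>x\<in>{0..1}.
     \<bar>rat_approx a b N x - h * (\<Sum>j=1..4*N. quadrature_integrand T (real j * h) x)\<bar> \<le> exp (- T))"
proof -
  define s where "s = (\<lambda>j::nat. exp (sqrt (real j * h) - T))"
  define c where "c = (\<lambda>j::nat. h / (pi * sqrt (real j * h)))"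
  have h0: "0 < h" by (simp add: h)
  have s0: "0 < s j" for j by (simp add: s_def)
  have c0: "0 \<le> c j" for j using h0 by (simp add: c_def)
  have sq: "exp (2 * (sqrt (real j * h) - T)) = (s j)\<^sup>2" for j unfolding s_def by (rule exp_double)
  have pole: "pole N j = - (s j)\<^sup>2" for j
  proof -
    have "sqrt h = sqrt 2 * pi" by (simp add: h real_sqrt_mult)
    then have "- sigma_c * (sqrt (real N) - sqrt (real j)) = 2 * (sqrt (real j * h) - T)"
      unfolding T sigma_c_def by (simp add: real_sqrt_mult algebra_simps)
    then show ?thesis unfolding pole_def sq [symmetric] by simp
  qed
  have quad: "h * quadrature_integrand T (real j * h) x = c j * s j * (x / ((s j)\<^sup>2 + x))" for j x
    unfolding quadrature_integrand_def sq c_def by (simp add: s_def field_simps)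
  have s1: "1 \<le> (s j)\<^sup>2" if "N \<le> j" for j
  proof -
    have "T \<le> sqrt (real j * h)" unfolding T using that h0 by simp
    then show ?thesis by (simp add: s_def)
  qed
  have "\<forall>j. \<exists>p. N < j \<longrightarrow> degree p \<le> n \<and>
      (\<forall>x\<in>{0..1}. \<bar>x / ((s j)\<^sup>2 + x) - poly p x\<bar> \<le> (1/3) ^ n / (s j)\<^sup>2)"
    using simple_fraction_polynomial_approx[OF s1, of _ n] by (meson less_imp_le)
  then obtain p where p: "\<And>j. N < j \<Longrightarrow> degree (p j) \<le> n"
      "\<And>j x. N < j \<Longrightarrow> x \<in> {0..1} \<Longrightarrow> \<bar>x / ((s j)\<^sup>2 + x) - poly (p j) x\<bar> \<le> (1/3) ^ n / (s j)\<^sup>2"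
    by metis
  \<comment> \<open>From x / (s^2 + x) = 1 - s^2 / (x + s^2): the second part yields the coefficient
    at the pole, the constant part moves into \<open>b\<close>.\<close>
  define a where "a = (\<lambda>j. - (c j * s j ^ 3))"
  define b where "b = [:\<Sum>j=1..N. c j * s j:] + (\<Sum>j=N+1..4*N. smult (c j * s j) (p j))"
  have "degree b \<le> n" unfolding b_def
    by (intro degree_add_le degree_sum_le) (auto intro!: order_trans[OF degree_smult_le] p)
  moreover have "\<bar>rat_approx a b N x - h * (\<Sum>j=1..4*N. quadrature_integrand T (real j * h) x)\<bar> \<le> exp (- T)"
    if x: "x \<in> {0..1}" for x
  proof -
    have frac: "a j / (x - pole N j) + c j * s j = c j * s j * (x / ((s j)\<^sup>2 + x))" for j
    proof -
      have "0 < (s j)\<^sup>2 + x" using s0[of j] x by (intro add_pos_nonneg) auto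
      then show ?thesis unfolding pole a_def
        by (simp add: field_simps power2_eq_square power3_eq_cube)
    qed
    have "{1..4*N} = {1..N} \<union> {N+1..4*N}" by auto
    then have "h * (\<Sum>j=1..4*N. quadrature_integrand T (real j * h) x)
        = (\<Sum>j=1..N. c j * s j * (x / ((s j)\<^sup>2 + x))) + (\<Sum>j=N+1..4*N. c j * s j * (x / ((s j)\<^sup>2 + x)))"
      unfolding sum_distrib_left quad by (simp only:) (subst sum.union_disjoint; auto)
    moreover have "rat_approx a b N x
        = (\<Sum>j=1..N. c j * s j * (x / ((s j)\<^sup>2 + x))) + (\<Sum>j=N+1..4*N. c j * s j * poly (p j) x)"
      unfolding rat_approx_def b_def frac [symmetric] sum.distrib by (simp add: poly_sum)
    ultimately have "rat_approx a b N x - h * (\<Sum>j=1..4*N. quadrature_integrand T (real j * h) x)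
        = - (\<Sum>j=N+1..4*N. c j * s j * (x / ((s j)\<^sup>2 + x) - poly (p j) x))"
      by (simp add: right_diff_distrib sum_subtractf)
    then have "\<bar>rat_approx a b N x - h * (\<Sum>j=1..4*N. quadrature_integrand T (real j * h) x)\<bar>
        \<le> (\<Sum>j=N+1..4*N. \<bar>c j * s j * (x / ((s j)\<^sup>2 + x) - poly (p j) x)\<bar>)"
      by (simp only: abs_minus_cancel sum_abs)
    also have "\<dots> \<le> (\<Sum>j=N+1..4*N. (1/3) ^ n * exp T / pi * (h / sqrt (real j * h) * exp (- sqrt (real j * h))))"
    proof (rule sum_mono)
      fix j assume j: "j \<in> {N+1..4*N}"
      have "\<bar>c j * s j * (x / ((s j)\<^sup>2 + x) - poly (p j) x)\<bar> = c j * s j * \<bar>x / ((s j)\<^sup>2 + x) - poly (p j) x\<bar>"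
        using c0[of j] s0[of j] by (simp add: abs_mult)
      also have "\<dots> \<le> c j * s j * ((1/3) ^ n / (s j)\<^sup>2)"
        using c0[of j] s0[of j] j x by (intro mult_left_mono p) auto
      also have "\<dots> = c j * (1/3) ^ n * (1 / s j)"
        using s0[of j] by (simp add: power2_eq_square)
      also have "1 / s j = exp T * exp (- sqrt (real j * h))"
        by (simp add: s_def exp_diff exp_minus field_simps)
      finally show "\<bar>c j * s j * (x / ((s j)\<^sup>2 + x) - poly (p j) x)\<bar>
          \<le> (1/3) ^ n * exp T / pi * (h / sqrt (real j * h) * exp (- sqrt (real j * h)))"
        by (simp add: c_def mult_ac)
    qed
    also have "\<dots> \<le> (\<Sum>j=1..4*N. (1/3) ^ n * exp T / pi * (h / sqrt (real j * h) * exp (- sqrt (real j * h))))"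
      using h0 by (intro sum_mono2) auto
    also have "\<dots> = (1/3) ^ n * exp T / pi * (\<Sum>j=1..4*N. h / sqrt (real j * h) * exp (- sqrt (real j * h)))"
      by (simp only: sum_distrib_left)
    also have "\<dots> \<le> (1/3) ^ n * exp T / pi * 2"
      by (intro mult_left_mono sum_exp_minus_sqrt_le h0) auto
    also have "\<dots> = (1/3) ^ n * exp T * (2 / pi)" by simp
    also have "\<dots> \<le> (1/3) ^ n * exp T * 1"
      using pi_ge_two by (intro mult_left_mono) auto
    \<comment> \<open>As 1/3 <= exp(-1) and n >= 2T, the geometric factor supplies exp(-2T): half
      cancels the growth exp T, half is the final error.\<close>
    also have "\<dots> \<le> exp (- (2 * T)) * exp T"
    proof -
      have "(1/3 :: real) ^ n \<le> exp (- 1) ^ n"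
        using exp_le by (intro power_mono) (auto simp: exp_minus field_simps)
      also have "\<dots> = exp (- real n)" by (simp flip: exp_of_nat_mult)
      also have "\<dots> \<le> exp (- (2 * T))" using n by simp
      finally show ?thesis by simp
    qed
    also have "\<dots> = exp (- T)" by (simp flip: exp_add)
    finally show ?thesis .
  qed
  ultimately show ?thesis by blast
qed

theorem theorem2p3:
  assumes hyp: "\<exists>N0::nat. \<forall>Nt::nat. Nt \<ge> N0 \<and> Nt > 0 \<longrightarrow>
     (let h = 2 * pi^2; T = sqrt (real Nt * h / 4) in
        \<forall>x \<in> {exp (4 - 2*T)..1}.
          cmod (contour_integral (Gamma_path T x) (\<lambda>u. f_int T u x * delta_fn h u))
            < 12 * exp (- T))"
  shows "\<exists>(a :: nat \<Rightarrow> nat \<Rightarrow> real) (b :: nat \<Rightarrow> real poly) (N2 :: nat \<Rightarrow> nat) C M0.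
           \<forall>N1::nat. N1 \<ge> M0 \<and> N1 > 0 \<longrightarrow>
             degree (b N1) \<le> N2 N1 \<and> real (N2 N1) \<le> C * sqrt (real N1) \<and>
             (\<forall>x \<in> {0..1::real}.
                \<bar>rat_approx (a N1) (b N1) N1 x - sqrt x\<bar>
                  \<le> C * exp (- pi * sqrt (2 * real (N1 + N2 N1))))"
proof -
  obtain N0 :: nat where N0: "\<And>Nt x. Nt \<ge> N0 \<Longrightarrow> Nt > 0 \<Longrightarrow>
      x \<in> {exp (4 - 2 * sqrt (real Nt * (2 * pi\<^sup>2) / 4))..1} \<Longrightarrow>
      cmod (contour_integral (Gamma_path (sqrt (real Nt * (2 * pi\<^sup>2) / 4)) x)
        (\<lambda>u. f_int (sqrt (real Nt * (2 * pi\<^sup>2) / 4)) u x * delta_fn (2 * pi\<^sup>2) u))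
        < 12 * exp (- sqrt (real Nt * (2 * pi\<^sup>2) / 4))"
    using hyp unfolding Let_def by blast
  define h where "h = 2 * pi\<^sup>2"
  define T where "T = (\<lambda>N::nat. sqrt (real N * h))"
  define N2 where "N2 = (\<lambda>N. nat \<lceil>2 * T N\<rceil>)"
  \<comment> \<open>K gives N2 <= 2T + 1 <= K sqrt(2 N1).\<close>
  define K where "K = 2 * pi + 1"
  \<comment> \<open>The summand 25 is 12 from the assumed contour bound, 12 from the trapezoidal
    error and 1 from the polynomial; exp 4 covers x near 0. The factor exp(pi K) pays for passing
    from N1 to N in the exponent.\<close>
  define C where "C = (25 + exp 4) * exp (pi * K)"
  have "1 < pi\<^sup>2" using pi_gt3 by (intro one_less_power) auto
  then have h1: "1 < h" unfolding h_def by linarith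
  have T_eq: "T N = pi * sqrt (2 * real N)" for N
    unfolding T_def h_def by (simp add: real_sqrt_mult mult_ac)
  have N2_ge: "2 * T N \<le> real (N2 N)" for N
    unfolding N2_def by linarith
  obtain a b where ab: "\<And>N. degree (b N) \<le> N2 N"
      "\<And>N x. x \<in> {0..1} \<Longrightarrow> \<bar>rat_approx (a N) (b N) N x
         - h * (\<Sum>j=1..4*N. quadrature_integrand (T N) (real j * h) x)\<bar> \<le> exp (- T N)"
    using quadrature_sum_rational[OF h_def T_def[THEN fun_cong] N2_ge] by metis
  have quad: "\<bar>h * (\<Sum>j=1..4*N. quadrature_integrand (T N) (real j * h) x) - sqrt x\<bar>
      \<le> (24 + exp 4) * exp (- T N)"
    if N: "N \<ge> N0" "N > 0" and x: "x \<in> {0..1}" for N x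
  proof (cases "x \<le> exp (4 - 2 * T N)")
    case True
    have "\<bar>h * (\<Sum>j=1..4*N. quadrature_integrand (T N) (real j * h) x) - sqrt x\<bar> \<le> exp 4 * exp (- T N)"
      using quadrature_error_near_zero[OF _ _ True] h1 x by simp
    also have "\<dots> \<le> (24 + exp 4) * exp (- T N)" by simp
    finally show ?thesis .
  next
    case False
    \<comment> \<open>The contour bound is used at \<open>Nt = 4 * N\<close>, for which sqrt(Nt h /
      4) is \<open>T N\<close>.\<close>
    have T4: "sqrt (real (4 * N) * (2 * pi\<^sup>2) / 4) = T N" by (simp add: T_def h_def)
    have "cmod (contour_integral (Gamma_path (T N) x) (\<lambda>u. f_int (T N) u x * delta_fn h u)) < 12 * exp (- T N)"
      using N0[of "4 * N" x, unfolded T4, folded h_def] N x False by simp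
    moreover have "\<bar>h * (\<Sum>j=1..4*N. quadrature_integrand (T N) (real j * h) x) - sqrt x\<bar>
        \<le> cmod (contour_integral (Gamma_path (T N) x) (\<lambda>u. f_int (T N) u x * delta_fn h u)) + 12 * exp (- T N)"
      by (rule trapezoidal_error_le_contour_integral)
         (use h1 N x False in \<open>auto simp: h_def T_def\<close>)
    ultimately have "\<bar>h * (\<Sum>j=1..4*N. quadrature_integrand (T N) (real j * h) x) - sqrt x\<bar> \<le> 24 * exp (- T N)"
      by linarith
    also have "\<dots> \<le> (24 + exp 4) * exp (- T N)" by simp
    finally show ?thesis .
  qed
  have N2_le: "real (N2 N) \<le> K * sqrt (2 * real N)" if "N > 0" for N
  proof -
    have "0 \<le> T N" by (simp add: T_eq)
    then have "real (N2 N) \<le> 2 * T N + 1" unfolding N2_def by linarith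
    also have "1 \<le> sqrt (2 * real N)" using that by simp
    finally show ?thesis by (simp add: T_eq K_def algebra_simps)
  qed
  have K0: "0 \<le> K" by (simp add: K_def)
  have "N2 N \<le> C * sqrt (real N)" if "N > 0" for N
  proof -
    have "K \<le> pi * K" using K0 pi_gt3 mult_right_mono[of 1 pi K] by simp
    also have "\<dots> \<le> exp (pi * K)" using exp_ge_add_one_self[of "pi * K"] by linarith
    finally have "K * sqrt 2 \<le> exp (pi * K) * (25 + exp 4)"
    proof (rule mult_mono)
      have "sqrt 2 \<le> (2::real)" using real_sqrt_le_mono[of 2 4] by simp
      then show "sqrt 2 \<le> 25 + exp (4::real)" using exp_gt_zero[of "4::real"] by linarith
    qed auto
    then have "K * sqrt 2 * sqrt (real N) \<le> C * sqrt (real N)"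
      by (intro mult_right_mono) (auto simp: C_def mult.commute)
    with N2_le[OF that] show ?thesis by (simp add: real_sqrt_mult mult.assoc)
  qed
  moreover have "\<bar>rat_approx (a N) (b N) N x - sqrt x\<bar> \<le> C * exp (- pi * sqrt (2 * real (N + N2 N)))"
    if N: "N \<ge> N0" "N > 0" and x: "x \<in> {0..1}" for N x
  proof -
    \<comment> \<open>Completing the square: N2 = O(sqrt N1) shifts the root by at most the constant
      K.\<close>
    have "sqrt (2 * real (N + N2 N)) \<le> sqrt (2 * real N) + K"
    proof (rule real_le_lsqrt)
      have "2 * real (N + N2 N) \<le> (sqrt (2 * real N))\<^sup>2 + 2 * (K * sqrt (2 * real N))"
        using N2_le[OF N(2)] by simp
      also have "\<dots> \<le> (sqrt (2 * real N) + K)\<^sup>2"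
        by (simp add: power2_sum)
      finally show "2 * real (N + N2 N) \<le> (sqrt (2 * real N) + K)\<^sup>2" .
    qed (use K0 in auto)
    then have "pi * sqrt (2 * real (N + N2 N)) \<le> T N + pi * K"
      using mult_left_mono[of "sqrt (2 * real (N + N2 N))" "sqrt (2 * real N) + K" pi]
      by (simp add: T_eq distrib_left)
    then have "exp (- T N) \<le> exp (pi * K + - pi * sqrt (2 * real (N + N2 N)))" by simp
    then have e: "exp (- T N) \<le> exp (pi * K) * exp (- pi * sqrt (2 * real (N + N2 N)))"
      by (simp only: exp_add)
    have "\<bar>rat_approx (a N) (b N) N x - sqrt x\<bar> \<le> (25 + exp 4) * exp (- T N)"
      using ab(2)[OF x, of N] quad[OF N x] by (simp add: algebra_simps)
    also have "\<dots> \<le> (25 + exp 4) * (exp (pi * K) * exp (- pi * sqrt (2 * real (N + N2 N))))"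
      using e by (intro mult_left_mono) (auto intro: add_nonneg_nonneg)
    finally show ?thesis by (simp add: C_def mult.assoc)
  qed
  ultimately show ?thesis
    using ab(1) by (intro exI[of _ a] exI[of _ b] exI[of _ N2] exI[of _ C] exI[of _ N0]) blast
qed

end
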